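(* For a nonnegative integer $n$ let $$F_n(x)=\sum_{k=0}^n\left(\binom nk x^k(1-x)^{n-k}\right)^2,\quad x\in[0,1].$$ Let $n\ge1$ be an integer. Then: (a) For all $x\in[0,1]$, $$F_n(x)=\frac1\pi\int_0^1\left(t+(1-t)(1-2x)^2\right)^n\frac{dt}{\sqrt{t(1-t)}},$$ $$2(n+1)F_{n+1}(x)-(2n+1)\bigl(1+(1-2x)^2\bigr)F_n(x)+2n(1-2x)^2F_{n-1}(x)=0,$$ $$(1-2x)\Bigl(F_{n+1}'(x)-\bigl(1-2x(1-x)\bigr)F_n'(x)\Bigr)=2\bigl(n+2x(1-x)\bigr)F_n(x)-2(n+1)F_{n+1}(x),$$ $$F_{n+1}'(x)-(1-2x)^2F_{n-1}'(x)=2(1-2x)\bigl((2n-1)F_{n-1}(x)-(2n+1)F_n(x)\bigr).$$ (b) $y=F_n$ is a solution to the differential equation $$x(1-x)(1-2x)y''(x)+\bigl(1+4(n-1)x(1-x)\bigr)y'(x)+2n(1-2x)y(x)=0.$$ Equivalently, $F_n$ is a polynomial solution to the Heun equation $$y''(x)+\left(\frac1x+\frac1{x-1}+\frac{-2n}{x-\frac12}\right)y'(x)+\frac{-2nx-(-n)}{x(x-1)\left(x-\frac12\right)}y(x)=0\qquad\left(x\notin\left\{0,\tfrac12,1\right\}\right),$$ with singular point $a=\frac12$ and parameters $\alpha=1$, $\beta=-2n$, $\gamma=1$, $\delta=1$, $\epsilon=-2n$, $q=-n$. (c) For all $x\in[0,1]$, $$F_n(x)\le\frac1{\sqrt{1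+4(n-1)x(1-x)}}.$$
   Context: The convention $0^0=1$ is used, so $F_0\equiv1$. The Heun equation with singular points $0,1,a$ and parameters $\alpha,\beta,\gamma,\delta,\epsilon,q$ (with $\gamma+\delta+\epsilon=\alpha+\beta+1$) is $$y''+\left(\frac{\gamma}{x}+\frac{\delta}{x-1}+\frac{\epsilon}{x-a}\right)y'+\frac{\alpha\beta x-q}{x(x-1)(x-a)}y=0.$$ *)

theory Defs
  imports "HOL-Analysis.Analysis" "HOL-Computational_Algebra.Polynomial"
begin

text \<open>
  The function is taken on all of \<open>\<real>\<close> (as the polynomial given by the formula), so that at the
  endpoints of \<open>[0,1]\<close> its two-sided derivatives are the one-sided derivatives of its restriction.
  Since \<open>0 ^ 0 = 1\<close>, we have \<open>bernstein_sq_sum 0 x = 1\<close> for all \<open>x\<close>.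
\<close>

definition bernstein_sq_sum :: "nat \<Rightarrow> real \<Rightarrow> real" where
  "bernstein_sq_sum n x = (\<Sum>k=0..n. (real (n choose k) * x ^ k * (1 - x) ^ (n - k))\<^sup>2)"

text \<open>
  \<open>y\<close> is, on the open set \<open>S\<close>, a classical (twice differentiable) solution of
  \<open>A y'' + B y' + C y = 0\<close>.
\<close>

definition solves_linear_ode2 ::
  "(real \<Rightarrow> real) \<Rightarrow> (real \<Rightarrow> real) \<Rightarrow> (real \<Rightarrow> real) \<Rightarrow> real set \<Rightarrow> (real \<Rightarrow> real) \<Rightarrow> bool" where
  "solves_linear_ode2 A B C S y \<longleftrightarrow> open S \<and>
     (\<exists>y' y''. \<forall>x\<in>S.
        (y has_real_derivative y' x) (at x) \<and>
        (y' has_real_derivative y'' x) (at x) \<and>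
        A x * y'' x + B x * y' x + C x * y x = 0)"

text \<open>
  \<open>y\<close> solves on \<open>S\<close> the Heun equation with singular points \<open>0\<close>, \<open>1\<close>, \<open>a\<close>.  The Fuchsian relation
  between the parameters belongs to the notion of a Heun equation; the singular points are kept
  out of \<open>S\<close> because division by zero is total.
\<close>

definition solves_Heun ::
  "real \<Rightarrow> real \<Rightarrow> real \<Rightarrow> real \<Rightarrow> real \<Rightarrow> real \<Rightarrow> real \<Rightarrow> real set \<Rightarrow> (real \<Rightarrow> real) \<Rightarrow> bool" where
  "solves_Heun a \<alpha> \<beta> \<gamma> \<delta> \<epsilon> q S y \<longleftrightarrow>
     a \<noteq> 0 \<and> a \<noteq> 1 \<and> \<gamma> + \<delta> + \<epsilon> = \<alpha> + \<beta> + 1 \<and> S \<subseteq> - {0, 1, a} \<and>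
     solves_linear_ode2
       (\<lambda>x. 1)
       (\<lambda>x. \<gamma> / x + \<delta> / (x - 1) + \<epsilon> / (x - a))
       (\<lambda>x. (\<alpha> * \<beta> * x - q) / (x * (x - 1) * (x - a)))
       S y"

end

theory Submission
  imports Defs
begin

text \<open>
  Parseval's identity for \<open>(1 - x + x e\<^sup>i\<^sup>\<phi>)\<^sup>n\<close> gives
  \<open>\<pi> F\<^sub>n(x) = \<integral> R\<^sup>n d\<phi>\<close> over \<open>[0, \<pi>]\<close>, where \<open>R = 1 - 2 x (1 - x) (1 - cos \<phi>)\<close>.
  The substitution \<open>t = (1 + cos \<phi>) / 2\<close> turns this into the integral of part (a).
  Integrating the derivative of \<open>R\<^sup>n sin \<phi>\<close> yields the three-term recurrence, and differentiating
  under the integral yields \<open>x (1 - x) F\<^sub>n' = n (1 - 2 x) (F\<^sub>n - F\<^sub>n\<^sub>-\<^sub>1)\<close>. After multiplication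
  by \<open>x (1 - x)\<close>, the other differential relations are algebraic consequences of these two.
  For (c), Bernoulli's inequality gives \<open>(1 - v)\<^sup>n \<le> 1 / (1 + (n - 1) v)\<close> on \<open>[0, 1]\<close>; with
  \<open>v = 1 - R\<close> the right-hand side is a multiple of a Poisson kernel, whose integral is known.
\<close>

section \<open>Fourier representation of the sum of squares\<close>

lemma integral_cos_int:
  fixes m :: int
  shows "((\<lambda>\<phi>. cos (of_int m * \<phi>)) has_integral (if m = 0 then pi else 0)) {0..pi}"
proof (cases "m = 0")
  case True
  then show ?thesis
    using has_integral_const_real[of "1::real" 0 pi] by simp
next
  case False
  have "((\<lambda>\<phi>. cos (of_int m * \<phi>)) has_integral
      sin (of_int m * pi) / of_int m - sin (of_int m * 0) / of_int m) {0..pi}"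
    by (rule fundamental_theorem_of_calculus)
      (auto simp: False has_real_derivative_iff_has_vector_derivative[symmetric]
        intro!: derivative_eq_intros)
  then show ?thesis
    using False by (simp add: mult.commute[of _ pi] sin_times_pi_eq_0 sin_npi_int)
qed

text \<open>The \<open>c k\<close> are the Fourier coefficients of \<open>z ^ n\<close>, and the
  integrand is the squared modulus of that power. The identity covers every real \<open>x\<close>,
  so it can later be differentiated in \<open>x\<close> on both sides of 0 and 1.\<close>

lemma bernstein_sq_integral:
  "((\<lambda>\<phi>. (1 - 2 * x * (1 - x) * (1 - cos \<phi>)) ^ n) has_integral pi * bernstein_sq_sum n x) {0..pi}"
proof -
  define c where "c k = real (n choose k) * x ^ k * (1 - x) ^ (n - k)" for k
  have expand: "(1 - 2 * x * (1 - x) * (1 - cos \<phi>)) ^ n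
      = (\<Sum>k\<le>n. \<Sum>j\<le>n. c k * c j * cos (of_int (int k - int j) * \<phi>))" for \<phi>
  proof -
    define z where "z = of_real (1 - x) + of_real x * cis \<phi>"
    have "z ^ n = (\<Sum>k\<le>n. of_nat (n choose k) * (of_real x * cis \<phi>) ^ k * of_real (1 - x) ^ (n - k))"
      unfolding z_def by (subst add.commute) (rule binomial_ring)
    also have "\<dots> = (\<Sum>k\<le>n. of_real (c k) * cis (real k * \<phi>))"
      by (intro sum.cong refl)
        (simp add: c_def power_mult_distrib Complex.DeMoivre mult_ac)
    finally have zn: "z ^ n = (\<Sum>k\<le>n. of_real (c k) * cis (real k * \<phi>))" .
    have "1 - 2 * x * (1 - x) * (1 - cos \<phi>) = (cmod z)\<^sup>2"
      unfolding cmod_power2 z_def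
      by (simp add: power_mult_distrib sin_squared_eq) (simp add: power2_eq_square algebra_simps)
    then have "(1 - 2 * x * (1 - x) * (1 - cos \<phi>)) ^ n = (cmod (z ^ n))\<^sup>2"
      by (simp add: norm_power power_mult[symmetric] mult.commute)
    also have "\<dots> = (\<Sum>k\<le>n. c k * cos (real k * \<phi>))\<^sup>2 + (\<Sum>k\<le>n. c k * sin (real k * \<phi>))\<^sup>2"
      unfolding cmod_power2 zn by simp
    \<comment> \<open>The real and imaginary squares are multiplied out and joined by the addition
      theorem for \<open>cos (k * \<phi> - j * \<phi>)\<close>.\<close>
    also have "\<dots> = (\<Sum>k\<le>n. \<Sum>j\<le>n. c k * c j * cos (of_int (int k - int j) * \<phi>))"
      unfolding power2_eq_square sum_product sum.distrib[symmetric]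
      by (intro sum.cong refl) (simp add: left_diff_distrib cos_diff algebra_simps)
    finally show ?thesis .
  qed
  have "((\<lambda>\<phi>. \<Sum>k\<le>n. \<Sum>j\<le>n. c k * c j * cos (of_int (int k - int j) * \<phi>)) has_integral
      (\<Sum>k\<le>n. \<Sum>j\<le>n. c k * c j * (if int k - int j = 0 then pi else 0))) {0..pi}"
    by (intro has_integral_sum has_integral_mult_right integral_cos_int) auto
  \<comment> \<open>Orthogonality of the cosines leaves only the diagonal
    \<open>k = j\<close>.\<close>
  moreover have "(\<Sum>k\<le>n. \<Sum>j\<le>n. c k * c j * (if int k - int j = 0 then pi else 0))
      = (\<Sum>k\<le>n. \<Sum>j\<le>n. if k = j then c k * c j * pi else 0)"
    by (intro sum.cong refl) auto
  moreover have "\<dots> = pi * bernstein_sq_sum n x"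
    by (simp add: sum.delta' bernstein_sq_sum_def c_def power2_eq_square atLeast0AtMost
        sum_distrib_left mult_ac)
  ultimately show ?thesis
    unfolding expand by simp
qed

section \<open>Recurrence and first derivative, both read off under the integral sign\<close>

text \<open>The same combination of powers of \<open>R\<close> is the exact derivative of
  \<open>2 * B * R ^ n * sin \<phi>\<close>, which vanishes at 0 and at \<open>pi\<close>. For
  \<open>n = 0\<close> the truncated index \<open>n - 1\<close> is harmless, since its coefficient
  is 0.\<close>

lemma bernstein_sq_recurrence:
  "2 * (real n + 1) * bernstein_sq_sum (n + 1) x
     - (2 * real n + 1) * (1 + (1 - 2 * x)\<^sup>2) * bernstein_sq_sum n x
     + 2 * real n * (1 - 2 * x)\<^sup>2 * bernstein_sq_sum (n - 1) x = 0"
  (is "?L = 0")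
proof -
  define B where "B = 2 * x * (1 - x)"
  define R where "R \<phi> = 1 - B * (1 - cos \<phi>)" for \<phi>
  have w: "(1 - 2 * x)\<^sup>2 = 1 - 2 * B"
    by (simp add: B_def power2_eq_square algebra_simps)
  let ?f = "\<lambda>\<phi>. 2 * (real n + 1) * R \<phi> ^ (n + 1)
      - (2 * real n + 1) * (1 + (1 - 2 * x)\<^sup>2) * R \<phi> ^ n
      + 2 * real n * (1 - 2 * x)\<^sup>2 * R \<phi> ^ (n - 1)"
  have deriv: "((\<lambda>\<phi>. 2 * B * (R \<phi> ^ n * sin \<phi>)) has_real_derivative ?f \<phi>) (at \<phi> within S)" for \<phi> S
  proof -
    \<comment> \<open>Here \<open>P\<close> and \<open>X\<close> stand for the powers
      \<open>n\<close> and \<open>n - 1\<close> of \<open>r\<close>. The relation between them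
      carries the factor \<open>N\<close> because \<open>P = X * r\<close> may fail for
      \<open>n = 0\<close>, where both powers are 1.\<close>
    have alg: "2 * B * (P * c + N * X * (- B * s) * s)
        = 2 * (N + 1) * (P * r) - (2 * N + 1) * (1 + (1 - 2 * B)) * P + 2 * N * (1 - 2 * B) * X"
      if "N * P = N * X * r" "B * c = r - (1 - B)" "s * s = 1 - c * c" for N P X r c s :: real
      using that by algebra
    have "2 * B * (R \<phi> ^ n * cos \<phi> + real n * R \<phi> ^ (n - 1) * (- B * sin \<phi>) * sin \<phi>)
        = 2 * (real n + 1) * (R \<phi> ^ n * R \<phi>)
          - (2 * real n + 1) * (1 + (1 - 2 * B)) * R \<phi> ^ n + 2 * real n * (1 - 2 * B) * R \<phi> ^ (n - 1)"
    proof (rule alg)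
      show "real n * R \<phi> ^ n = real n * R \<phi> ^ (n - 1) * R \<phi>"
        by (cases n) auto
      show "B * cos \<phi> = R \<phi> - (1 - B)"
        by (simp add: R_def algebra_simps)
      show "sin \<phi> * sin \<phi> = 1 - cos \<phi> * cos \<phi>"
        using sin_squared_eq[of \<phi>] by (simp add: power2_eq_square)
    qed
    then have "2 * B * (R \<phi> ^ n * cos \<phi> + real n * R \<phi> ^ (n - 1) * (- B * sin \<phi>) * sin \<phi>) = ?f \<phi>"
      unfolding w by (simp add: mult_ac)
    moreover have "((\<lambda>\<phi>. 2 * B * (R \<phi> ^ n * sin \<phi>)) has_real_derivative
        2 * B * (R \<phi> ^ n * cos \<phi> + real n * R \<phi> ^ (n - 1) * (- B * sin \<phi>) * sin \<phi>)) (at \<phi> within S)"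
      unfolding R_def by (auto intro!: derivative_eq_intros)
    ultimately show ?thesis
      by simp
  qed
  have "(?f has_integral 2 * B * (R pi ^ n * sin pi) - 2 * B * (R 0 ^ n * sin 0)) {0..pi}"
    using deriv by (intro fundamental_theorem_of_calculus)
      (auto simp: has_real_derivative_iff_has_vector_derivative[symmetric])
  then have "(?f has_integral 0) {0..pi}"
    by simp
  moreover have "(?f has_integral 2 * (real n + 1) * (pi * bernstein_sq_sum (n + 1) x)
      - (2 * real n + 1) * (1 + (1 - 2 * x)\<^sup>2) * (pi * bernstein_sq_sum n x)
      + 2 * real n * (1 - 2 * x)\<^sup>2 * (pi * bernstein_sq_sum (n - 1) x)) {0..pi}"
    unfolding R_def B_def
    by (intro has_integral_add has_integral_diff has_integral_mult_right bernstein_sq_integral)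
  ultimately have "pi * ?L = 0"
    by (auto dest: has_integral_unique simp: algebra_simps)
  then show ?thesis
    by simp
qed

text \<open>With \<open>[:0, 1:]\<close> as the variable and \<open>[:1, -1:]\<close> as one minus
  it, all derivatives become \<open>pderiv\<close>. This settles differentiability and continuity at
  once.\<close>

definition bernstein_sq_poly :: "nat \<Rightarrow> real poly" where
  "bernstein_sq_poly n = (\<Sum>k=0..n. (smult (real (n choose k)) ([:0, 1:] ^ k * [:1, -1:] ^ (n - k)))\<^sup>2)"

lemma bernstein_sq_sum_poly: "bernstein_sq_sum n = poly (bernstein_sq_poly n)"
  by (rule ext) (simp add: bernstein_sq_sum_def bernstein_sq_poly_def poly_sum poly_power mult_ac)

lemma deriv_bernstein_sq_sum: "deriv (bernstein_sq_sum n) = poly (pderiv (bernstein_sq_poly n))"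
  unfolding bernstein_sq_sum_poly by (intro ext DERIV_imp_deriv poly_DERIV)

text \<open>The \<open>x\<close>-derivative of \<open>R\<close> is
  \<open>- 2 * (1 - 2 * x) * (1 - cos \<phi>)\<close>. Multiplying by \<open>x * (1 - x)\<close>
  turns it into \<open>(1 - 2 * x) * (R - 1)\<close>, so only powers of \<open>R\<close> remain in
  the integrand.\<close>

lemma bernstein_sq_deriv:
  "x * (1 - x) * deriv (bernstein_sq_sum n) x
     = real n * (1 - 2 * x) * (bernstein_sq_sum n x - bernstein_sq_sum (n - 1) x)"
proof -
  let ?R = "\<lambda>x \<phi>. 1 - 2 * x * (1 - x) * (1 - cos \<phi>)"
  let ?D = "\<lambda>x \<phi>. real n * ?R x \<phi> ^ (n - 1) * (- (2 * (1 - 2 * x) * (1 - cos \<phi>)))"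
  have "((\<lambda>x. integral (cbox 0 pi) (\<lambda>\<phi>. ?R x \<phi> ^ n)) has_field_derivative
      integral (cbox 0 pi) (?D x)) (at x within UNIV)"
  proof (rule leibniz_rule_field_derivative)
    show "((\<lambda>x. ?R x \<phi> ^ n) has_real_derivative ?D x \<phi>) (at x within UNIV)" for x \<phi>
      by (auto intro!: derivative_eq_intros simp: algebra_simps)
    show "(\<lambda>\<phi>. ?R x \<phi> ^ n) integrable_on cbox 0 pi" for x
      by (intro integrable_continuous continuous_intros)
    show "continuous_on (UNIV \<times> cbox 0 pi) (\<lambda>(x, \<phi>). ?D x \<phi>)"
      unfolding case_prod_unfold by (intro continuous_intros)
  qed auto
  then have "((\<lambda>x. pi * bernstein_sq_sum n x) has_field_derivative integral {0..pi} (?D x)) (at x)"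
    using bernstein_sq_integral[THEN integral_unique] by simp
  moreover have "((\<lambda>x. pi * bernstein_sq_sum n x) has_field_derivative
      pi * deriv (bernstein_sq_sum n) x) (at x)"
    unfolding deriv_bernstein_sq_sum unfolding bernstein_sq_sum_poly
    by (intro DERIV_cmult poly_DERIV)
  ultimately have eq: "pi * deriv (bernstein_sq_sum n) x = integral {0..pi} (?D x)"
    by (rule DERIV_unique[symmetric])
  have "?D x integrable_on {0..pi}"
    by (intro integrable_continuous_interval continuous_intros)
  then have "(?D x has_integral pi * deriv (bernstein_sq_sum n) x) {0..pi}"
    unfolding eq by (rule integrable_integral)
  then have "((\<lambda>\<phi>. x * (1 - x) * ?D x \<phi>) has_integral
      x * (1 - x) * (pi * deriv (bernstein_sq_sum n) x)) {0..pi}"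
    by (rule has_integral_mult_right)
  moreover have "x * (1 - x) * ?D x \<phi> = real n * (1 - 2 * x) * (?R x \<phi> ^ n - ?R x \<phi> ^ (n - 1))" for \<phi>
    by (cases n) (simp_all add: algebra_simps)
  moreover have "((\<lambda>\<phi>. real n * (1 - 2 * x) * (?R x \<phi> ^ n - ?R x \<phi> ^ (n - 1))) has_integral
      real n * (1 - 2 * x) * (pi * bernstein_sq_sum n x - pi * bernstein_sq_sum (n - 1) x)) {0..pi}"
    by (intro has_integral_mult_right has_integral_diff bernstein_sq_integral)
  ultimately have "x * (1 - x) * (pi * deriv (bernstein_sq_sum n) x)
      = real n * (1 - 2 * x) * (pi * bernstein_sq_sum n x - pi * bernstein_sq_sum (n - 1) x)"
    by (simp only: has_integral_unique)
  then have "pi * (x * (1 - x) * deriv (bernstein_sq_sum n) x)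
      = pi * (real n * (1 - 2 * x) * (bernstein_sq_sum n x - bernstein_sq_sum (n - 1) x))"
    by (simp add: algebra_simps)
  then show ?thesis
    by simp
qed

section \<open>The integral with arcsine weight\<close>

text \<open>Absolute integrability is carried along with the value, because \<open>integral\<close>
  defaults to 0 on functions that are not integrable and the weight is singular at both
  ends.\<close>

lemma bernstein_sq_arcsine_integral:
  fixes n :: nat and x :: real
  defines "f \<equiv> \<lambda>t. (t + (1 - t) * (1 - 2 * x)\<^sup>2) ^ n / sqrt (t * (1 - t))"
  shows "f absolutely_integrable_on {0..1} \<and> bernstein_sq_sum n x = 1 / pi * integral {0..1} f"
proof -
  define g where "g \<phi> = (1 + cos \<phi>) / 2" for \<phi> :: real
  define h where "h \<phi> = (1 - 2 * x * (1 - x) * (1 - cos \<phi>)) ^ n" for \<phi> :: real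
  have image: "g ` {0<..<pi} = {0<..<1}"
  proof
    show "g ` {0<..<pi} \<subseteq> {0<..<1}"
    proof
      fix t assume "t \<in> g ` {0<..<pi}"
      then obtain \<phi> where "0 < \<phi>" "\<phi> < pi" "t = g \<phi>"
        by auto
      then show "t \<in> {0<..<1}"
        using cos_monotone_0_pi[of 0 \<phi>] cos_monotone_0_pi[of \<phi> pi] by (simp add: g_def)
    qed
    show "{0<..<1} \<subseteq> g ` {0<..<pi}"
    proof
      fix t :: real assume "t \<in> {0<..<1}"
      then have "arccos (2 * t - 1) \<in> {0<..<pi}" "g (arccos (2 * t - 1)) = t"
        using arccos_lt_bounded[of "2 * t - 1"] by (auto simp: g_def)
      then show "t \<in> g ` {0<..<pi}"
        by (metis imageI)
    qed
  qed
  \<comment> \<open>The Jacobian \<open>sin \<phi> / 2\<close> equals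
    \<open>sqrt (t * (1 - t))\<close> at \<open>t = g \<phi>\<close>, so the weight cancels. The
    absolute value is there because \<open>g\<close> is decreasing.\<close>
  have pullback: "\<bar>- sin \<phi> / 2\<bar> * f (g \<phi>) = h \<phi>" if "\<phi> \<in> {0<..<pi}" for \<phi>
  proof -
    have "g \<phi> * (1 - g \<phi>) = (sin \<phi> / 2)\<^sup>2"
      by (simp add: g_def power_divide sin_squared_eq) (simp add: power2_eq_square field_simps)
    moreover have "g \<phi> + (1 - g \<phi>) * (1 - 2 * x)\<^sup>2 = 1 - 2 * x * (1 - x) * (1 - cos \<phi>)"
      by (simp add: g_def power2_eq_square field_simps)
    moreover have "sin \<phi> > 0"
      using that by (simp add: sin_gt_zero)
    ultimately show ?thesis
      by (simp add: f_def h_def)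
  qed
  have "(h absolutely_integrable_on {0..pi}) \<and> integral {0..pi} h = pi * bernstein_sq_sum n x"
    unfolding h_def using bernstein_sq_integral[of x n]
    by (auto intro!: absolutely_integrable_continuous_real continuous_intros)
  \<comment> \<open>Endpoints are dropped since \<open>pullback\<close> fails at
    \<open>\<phi> = 0\<close>: its left side is 0 there, while \<open>h 0 = 1\<close>.\<close>
  then have "(h absolutely_integrable_on {0<..<pi}) \<and> integral {0<..<pi} h = pi * bernstein_sq_sum n x"
    by (simp add: absolutely_integrable_on_Icc_iff_Ioo integral_open_interval_real)
  then have "(\<lambda>\<phi>. \<bar>- sin \<phi> / 2\<bar> * f (g \<phi>)) absolutely_integrable_on {0<..<pi} \<and>
      integral {0<..<pi} (\<lambda>\<phi>. \<bar>- sin \<phi> / 2\<bar> * f (g \<phi>)) = pi * bernstein_sq_sum n x"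
    using set_integrable_cong[OF refl refl pullback, of "{0<..<pi}" "\<lambda>\<phi>. \<phi>" lebesgue]
      integral_cong[of "{0<..<pi}", OF pullback, of "\<lambda>\<phi>. \<phi>"] by simp
  moreover have "inj_on g {0<..<pi}"
    by (auto simp: g_def inj_on_def intro: cos_inj_pi)
  moreover have "(g has_real_derivative - sin \<phi> / 2) (at \<phi> within {0<..<pi})" for \<phi>
    unfolding g_def by (auto intro!: derivative_eq_intros)
  ultimately have "f absolutely_integrable_on g ` {0<..<pi} \<and>
      integral (g ` {0<..<pi}) f = pi * bernstein_sq_sum n x"
    by (subst has_absolute_integral_change_of_variables_1'[symmetric]) auto
  then show ?thesis
    by (simp add: image absolutely_integrable_on_Icc_iff_Ioo integral_open_interval_real)
qed

section \<open>First-order differential relations\<close>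

lemma continuous_on_bernstein_sq_sum [continuous_intros]:
  "continuous_on S (bernstein_sq_sum n)"
  unfolding bernstein_sq_sum_poly by (intro continuous_intros)

lemma continuous_on_deriv_bernstein_sq_sum [continuous_intros]:
  "continuous_on S (deriv (bernstein_sq_sum n))"
  unfolding deriv_bernstein_sq_sum by (intro continuous_intros)

text \<open>Continuous functions that agree on the dense complement of \<open>{0, 1}\<close> agree
  everywhere. This recovers the relations at 0 and 1, where \<open>bernstein_sq_deriv\<close>
  carries no information about the derivative.\<close>

lemma continuous_mult_left_cancel:
  fixes f g :: "real \<Rightarrow> real"
  assumes "continuous_on UNIV f" "continuous_on UNIV g"
    and eq: "\<And>x. x * (1 - x) * f x = x * (1 - x) * g x"
  shows "f x = g x"
proof -
  have closure: "closure (- {0, 1 :: real}) = UNIV"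
    by (simp add: closure_complement empty_interior_finite)
  have "f x - g x = 0"
  proof (rule continuous_constant_on_closure[where S = "- {0, 1 :: real}" and f = "\<lambda>x. f x - g x"])
    show "f x - g x = 0" if "x \<in> - {0, 1}" for x
      using eq[of x] that by auto
  qed (use assms closure in \<open>auto intro!: continuous_intros\<close>)
  then show ?thesis
    by simp
qed

text \<open>After multiplication by \<open>x * (1 - x)\<close> both derivatives are replaced through
  \<open>bernstein_sq_deriv\<close>, and the recurrence eliminates the value at
  \<open>n - 1\<close>.\<close>

lemma bernstein_sq_deriv_Suc:
  "(1 - 2 * x) * (deriv (bernstein_sq_sum (n + 1)) x
      - (1 - 2 * x * (1 - x)) * deriv (bernstein_sq_sum n) x)
    = 2 * (real n + 2 * x * (1 - x)) * bernstein_sq_sum n x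
      - 2 * (real n + 1) * bernstein_sq_sum (n + 1) x"
  (is "?f x = ?g x")
proof (rule continuous_mult_left_cancel[of ?f ?g])
  fix x :: real
  have alg: "x * (1 - x) * ((1 - 2 * x) * (d1 - (1 - 2 * x * (1 - x)) * d0))
      = x * (1 - x) * (2 * (N + 2 * x * (1 - x)) * F0 - 2 * (N + 1) * F1)"
    if "x * (1 - x) * d1 = (N + 1) * (1 - 2 * x) * (F1 - F0)"
      "x * (1 - x) * d0 = N * (1 - 2 * x) * (F0 - Fm)"
      "2 * (N + 1) * F1 - (2 * N + 1) * (1 + (1 - 2 * x)\<^sup>2) * F0 + 2 * N * (1 - 2 * x)\<^sup>2 * Fm = 0"
    for N F1 F0 Fm d1 d0
    using that by algebra
  show "x * (1 - x) * ((1 - 2 * x) * (deriv (bernstein_sq_sum (n + 1)) x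
      - (1 - 2 * x * (1 - x)) * deriv (bernstein_sq_sum n) x))
    = x * (1 - x) * (2 * (real n + 2 * x * (1 - x)) * bernstein_sq_sum n x
      - 2 * (real n + 1) * bernstein_sq_sum (n + 1) x)"
    using bernstein_sq_deriv[of x "n + 1"] bernstein_sq_deriv[of x n] bernstein_sq_recurrence[of n x]
    by (intro alg) (simp_all add: add.commute)
qed (intro continuous_intros)+

lemma bernstein_sq_deriv_diff:
  assumes "n \<ge> 1"
  shows "deriv (bernstein_sq_sum (n + 1)) x - (1 - 2 * x)\<^sup>2 * deriv (bernstein_sq_sum (n - 1)) x
    = 2 * (1 - 2 * x) * ((2 * real n - 1) * bernstein_sq_sum (n - 1) x
      - (2 * real n + 1) * bernstein_sq_sum n x)"
  (is "?f x = ?g x")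
proof (rule continuous_mult_left_cancel[of ?f ?g])
  fix x :: real
  \<comment> \<open>\<open>F2\<close>, \<open>F1\<close>, \<open>F0\<close>, \<open>Fm\<close> are
    the values at \<open>n + 1\<close>, \<open>n\<close>, \<open>n - 1\<close>,
    \<open>n - 1 - 1\<close>. The recurrences at \<open>n\<close> and \<open>n - 1\<close> eliminate
    the outer two. For \<open>n = 1\<close> the last index is truncated to 0, but its coefficient
    \<open>N - 1\<close> is then 0.\<close>
  have alg: "x * (1 - x) * (d2 - (1 - 2 * x)\<^sup>2 * d0)
      = x * (1 - x) * (2 * (1 - 2 * x) * ((2 * N - 1) * F0 - (2 * N + 1) * F1))"
    if "x * (1 - x) * d2 = (N + 1) * (1 - 2 * x) * (F2 - F1)"
      "x * (1 - x) * d0 = (N - 1) * (1 - 2 * x) * (F0 - Fm)"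
      "2 * N * F1 - (2 * N - 1) * (1 + (1 - 2 * x)\<^sup>2) * F0 + 2 * (N - 1) * (1 - 2 * x)\<^sup>2 * Fm = 0"
      "2 * (N + 1) * F2 - (2 * N + 1) * (1 + (1 - 2 * x)\<^sup>2) * F1 + 2 * N * (1 - 2 * x)\<^sup>2 * F0 = 0"
    for N F2 F1 F0 Fm d2 d0
    using that by algebra
  have pred: "real (n - 1) = real n - 1" "n - 1 + 1 = n"
    using assms by auto
  show "x * (1 - x) * (deriv (bernstein_sq_sum (n + 1)) x
        - (1 - 2 * x)\<^sup>2 * deriv (bernstein_sq_sum (n - 1)) x)
    = x * (1 - x) * (2 * (1 - 2 * x) * ((2 * real n - 1) * bernstein_sq_sum (n - 1) x
      - (2 * real n + 1) * bernstein_sq_sum n x))"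
  proof (rule alg)
    show "x * (1 - x) * deriv (bernstein_sq_sum (n + 1)) x
        = (real n + 1) * (1 - 2 * x) * (bernstein_sq_sum (n + 1) x - bernstein_sq_sum n x)"
      using bernstein_sq_deriv[of x "n + 1"] by (simp add: add.commute)
    show "2 * real n * bernstein_sq_sum n x
        - (2 * real n - 1) * (1 + (1 - 2 * x)\<^sup>2) * bernstein_sq_sum (n - 1) x
        + 2 * (real n - 1) * (1 - 2 * x)\<^sup>2 * bernstein_sq_sum (n - 1 - 1) x = 0"
      using bernstein_sq_recurrence[of "n - 1" x] unfolding pred by simp
  qed (use bernstein_sq_deriv[of x "n - 1"] bernstein_sq_recurrence[of n x] pred in simp_all)
qed (intro continuous_intros)+

section \<open>The second-order equation and its Heun form\<close>

lemma deriv_deriv_bernstein_sq_sum: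
  "deriv (deriv (bernstein_sq_sum n)) = poly (pderiv (pderiv (bernstein_sq_poly n)))"
  unfolding deriv_bernstein_sq_sum by (intro ext DERIV_imp_deriv poly_DERIV)

lemma bernstein_sq_sum_DERIV:
  "(bernstein_sq_sum n has_real_derivative deriv (bernstein_sq_sum n) x) (at x)"
  unfolding deriv_bernstein_sq_sum unfolding bernstein_sq_sum_poly by (rule poly_DERIV)

lemma deriv_bernstein_sq_sum_DERIV:
  "(deriv (bernstein_sq_sum n) has_real_derivative deriv (deriv (bernstein_sq_sum n)) x) (at x)"
  unfolding deriv_deriv_bernstein_sq_sum unfolding deriv_bernstein_sq_sum by (rule poly_DERIV)

text \<open>Differentiating \<open>bernstein_sq_deriv\<close> once more brings in the second
  derivative. The first-order relations at \<open>n\<close> and \<open>n - 1\<close>, with the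
  recurrence at \<open>n - 1\<close>, then remove the lower-index terms \<open>G\<close>,
  \<open>H\<close> and \<open>g\<close>.\<close>

lemma bernstein_sq_ode:
  assumes "n \<ge> 1"
  shows "x * (1 - x) * (1 - 2 * x) * deriv (deriv (bernstein_sq_sum n)) x
    + (1 + 4 * (real n - 1) * x * (1 - x)) * deriv (bernstein_sq_sum n) x
    + 2 * real n * (1 - 2 * x) * bernstein_sq_sum n x = 0"
  (is "?f x = 0")
proof (rule continuous_mult_left_cancel[of ?f "\<lambda>_. 0"])
  fix x :: real
  let ?F = "bernstein_sq_sum"
  have alg: "x * (1 - x) * (x * (1 - x) * (1 - 2 * x) * s + (1 + 4 * (N - 1) * x * (1 - x)) * f
      + 2 * N * (1 - 2 * x) * F) = x * (1 - x) * 0"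
    if "(1 - 2 * x) * f + x * (1 - x) * s = - 2 * N * (F - G) + N * (1 - 2 * x) * (f - g)"
      "x * (1 - x) * f = N * (1 - 2 * x) * (F - G)"
      "x * (1 - x) * g = (N - 1) * (1 - 2 * x) * (G - H)"
      "2 * N * F - (2 * N - 1) * (1 + (1 - 2 * x)\<^sup>2) * G + 2 * (N - 1) * (1 - 2 * x)\<^sup>2 * H = 0"
    for N F G H f g s
    using that by algebra
  have pred: "real (n - 1) = real n - 1" "n - 1 + 1 = n"
    using assms by auto
  have "((\<lambda>x. x * (1 - x) * deriv (?F n) x) has_real_derivative
      (1 - 2 * x) * deriv (?F n) x + x * (1 - x) * deriv (deriv (?F n)) x) (at x)"
    by (auto intro!: derivative_eq_intros deriv_bernstein_sq_sum_DERIV simp: algebra_simps)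
  moreover have "((\<lambda>x. real n * (1 - 2 * x) * (?F n x - ?F (n - 1) x)) has_real_derivative
      - 2 * real n * (?F n x - ?F (n - 1) x)
      + real n * (1 - 2 * x) * (deriv (?F n) x - deriv (?F (n - 1)) x)) (at x)"
    by (auto intro!: derivative_eq_intros bernstein_sq_sum_DERIV simp: algebra_simps)
  \<comment> \<open>Unfolding \<open>bernstein_sq_deriv\<close> makes the two differentiated
    functions identical, so their derivatives coincide.\<close>
  ultimately have deriv2: "(1 - 2 * x) * deriv (?F n) x + x * (1 - x) * deriv (deriv (?F n)) x
      = - 2 * real n * (?F n x - ?F (n - 1) x)
      + real n * (1 - 2 * x) * (deriv (?F n) x - deriv (?F (n - 1)) x)"
    unfolding bernstein_sq_deriv by (rule DERIV_unique)
  show "x * (1 - x) * (x * (1 - x) * (1 - 2 * x) * deriv (deriv (?F n)) x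
      + (1 + 4 * (real n - 1) * x * (1 - x)) * deriv (?F n) x
      + 2 * real n * (1 - 2 * x) * ?F n x) = x * (1 - x) * 0"
  proof (rule alg[OF deriv2 bernstein_sq_deriv])
    show "2 * real n * ?F n x - (2 * real n - 1) * (1 + (1 - 2 * x)\<^sup>2) * ?F (n - 1) x
        + 2 * (real n - 1) * (1 - 2 * x)\<^sup>2 * ?F (n - 1 - 1) x = 0"
      using bernstein_sq_recurrence[of "n - 1" x] unfolding pred by simp
  qed (use bernstein_sq_deriv[of x "n - 1"] pred in simp)
next
  show "continuous_on UNIV (\<lambda>x. x * (1 - x) * (1 - 2 * x) * deriv (deriv (bernstein_sq_sum n)) x
    + (1 + 4 * (real n - 1) * x * (1 - x)) * deriv (bernstein_sq_sum n) x
    + 2 * real n * (1 - 2 * x) * bernstein_sq_sum n x)"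
    unfolding deriv_deriv_bernstein_sq_sum by (intro continuous_intros)
qed (intro continuous_intros)

lemma bernstein_sq_solves_ode:
  assumes "n \<ge> 1" "open S"
  shows "solves_linear_ode2 (\<lambda>x. x * (1 - x) * (1 - 2 * x))
    (\<lambda>x. 1 + 4 * (real n - 1) * x * (1 - x)) (\<lambda>x. 2 * real n * (1 - 2 * x)) S (bernstein_sq_sum n)"
  unfolding solves_linear_ode2_def
  using assms bernstein_sq_sum_DERIV deriv_bernstein_sq_sum_DERIV bernstein_sq_ode[OF assms(1)]
  by blast

lemma solves_linear_ode2_scale:
  assumes "\<And>x. x \<in> S \<Longrightarrow> c x \<noteq> 0"
    and "\<And>x. x \<in> S \<Longrightarrow> A x = c x * A' x"
    and "\<And>x. x \<in> S \<Longrightarrow> B x = c x * B' x"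
    and "\<And>x. x \<in> S \<Longrightarrow> C x = c x * C' x"
  shows "solves_linear_ode2 A B C S y \<longleftrightarrow> solves_linear_ode2 A' B' C' S y"
proof -
  have "A x * y2 + B x * y1 + C x * y0 = c x * (A' x * y2 + B' x * y1 + C' x * y0)"
    if "x \<in> S" for x y0 y1 y2
    using assms(2-4)[OF that] by (simp add: algebra_simps)
  then have "A x * y2 + B x * y1 + C x * y0 = 0 \<longleftrightarrow> A' x * y2 + B' x * y1 + C' x * y0 = 0"
    if "x \<in> S" for x y0 y1 y2
    using assms(1) that by simp
  then show ?thesis
    unfolding solves_linear_ode2_def by simp
qed

text \<open>The leading coefficient is \<open>2 * x * (x - 1) * (x - 1/2)\<close>, nonzero off the
  singular points. Dividing by it gives the Heun coefficients in partial fractions, and the Fuchsian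
  relation reads \<open>2 - 2 * n\<close> on both sides.\<close>

lemma ode_iff_Heun:
  fixes n :: nat
  shows "solves_linear_ode2 (\<lambda>x. x * (1 - x) * (1 - 2 * x))
      (\<lambda>x. 1 + 4 * (real n - 1) * x * (1 - x)) (\<lambda>x. 2 * real n * (1 - 2 * x)) (- {0, 1/2, 1}) y
    \<longleftrightarrow> solves_Heun (1/2) 1 (- 2 * real n) 1 1 (- 2 * real n) (- real n) (- {0, 1/2, 1}) y"
proof -
  have "solves_linear_ode2 (\<lambda>x. x * (1 - x) * (1 - 2 * x))
      (\<lambda>x. 1 + 4 * (real n - 1) * x * (1 - x)) (\<lambda>x. 2 * real n * (1 - 2 * x)) (- {0, 1/2, 1}) y
    \<longleftrightarrow> solves_linear_ode2 (\<lambda>x. 1) (\<lambda>x. 1 / x + 1 / (x - 1) + - 2 * real n / (x - 1/2))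
      (\<lambda>x. (1 * (- 2 * real n) * x - - real n) / (x * (x - 1) * (x - 1/2))) (- {0, 1/2, 1}) y"
  proof (rule solves_linear_ode2_scale[where c = "\<lambda>x. x * (1 - x) * (1 - 2 * x)"])
    fix x :: real assume "x \<in> - {0, 1/2, 1}"
    then have nz: "x \<noteq> 0" "x - 1 \<noteq> 0" "x - 1/2 \<noteq> 0"
      by auto
    then show "x * (1 - x) * (1 - 2 * x) \<noteq> 0"
      by auto
    have c: "x * (1 - x) * (1 - 2 * x) = 2 * (x * (x - 1) * (x - 1/2))"
      by (simp add: field_simps)
    have alg: "a * b * c * (1 / a + 1 / b + k / c) = b * c + a * c + k * (a * b)"
      if "a \<noteq> 0" "b \<noteq> 0" "c \<noteq> 0" for a b c k :: real
      using that by (simp add: field_simps)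
    have "1 + 4 * (real n - 1) * x * (1 - x)
        = 2 * ((x - 1) * (x - 1/2) + x * (x - 1/2) + - 2 * real n * (x * (x - 1)))"
      by (simp add: field_simps)
    also have "\<dots> = x * (1 - x) * (1 - 2 * x) * (1 / x + 1 / (x - 1) + - 2 * real n / (x - 1/2))"
      unfolding c alg[OF nz, symmetric] by (simp only: mult.assoc)
    finally show "1 + 4 * (real n - 1) * x * (1 - x) = x * (1 - x) * (1 - 2 * x) *
        (1 / x + 1 / (x - 1) + - 2 * real n / (x - 1/2))" .
    show "2 * real n * (1 - 2 * x) = x * (1 - x) * (1 - 2 * x) *
        ((1 * (- 2 * real n) * x - - real n) / (x * (x - 1) * (x - 1/2)))"
    proof -
      have cancel: "k = 2 * d * (l / d)" if "d \<noteq> 0" "k = 2 * l" for d k l :: real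
        using that by simp
      show ?thesis
        unfolding c by (rule cancel) (use nz in simp, simp add: algebra_simps)
    qed
  qed simp
  then show ?thesis
    unfolding solves_Heun_def by auto
qed

section \<open>Poisson kernel and the upper bound\<close>

lemma poisson_kernel_integral:
  fixes y :: real
  assumes "y \<ge> 0"
  shows "((\<lambda>\<phi>. 1 / (1 + y * (1 - cos \<phi>) / 2)) has_integral pi / sqrt (1 + y)) {0..pi}"
proof -
  \<comment> \<open>The parameters are chosen so that the integrand is \<open>(1 - q)\<^sup>2 / (1 - 2 q cos \<phi> + q\<^sup>2)\<close>.\<close>
  define m where "m = sqrt (1 + y)"
  define q where "q = (m - 1) / (m + 1)"
  have m: "m \<ge> 1" "y = m\<^sup>2 - 1"
    using assms by (auto simp: m_def)
  have q: "0 \<le> q" "q < 1" and m_q: "m = (1 + q) / (1 - q)"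
    using m(1) by (auto simp: q_def field_simps)
  \<comment> \<open>This positivity keeps the quotient inside \<open>arctan\<close> smooth on all of
    \<open>[0, pi]\<close>, so one antiderivative serves the whole interval.\<close>
  have cos: "1 - q * cos \<phi> > 0" for \<phi>
  proof -
    have "q * cos \<phi> \<le> q * 1"
      using q by (intro mult_left_mono) auto
    then show ?thesis
      using q by simp
  qed
  define D where "D \<phi> = 1 + q\<^sup>2 - 2 * q * cos \<phi>" for \<phi>
  \<comment> \<open>\<open>D \<phi>\<close> is the squared modulus of
    \<open>1 - q * cis \<phi>\<close>.\<close>
  have D: "D \<phi> = (1 - q * cos \<phi>)\<^sup>2 + (q * sin \<phi>)\<^sup>2" for \<phi>
    by (simp add: D_def power_mult_distrib sin_squared_eq) (simp add: power2_eq_square algebra_simps)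
  have D_pos: "D \<phi> > 0" for \<phi>
    unfolding D using cos[of \<phi>] by (simp add: add_pos_nonneg)
  have kernel: "1 / (1 + y * (1 - cos \<phi>) / 2) = (1 - q)\<^sup>2 / D \<phi>" for \<phi>
  proof -
    have "(1 - q)\<^sup>2 * y = (m * (1 - q))\<^sup>2 - (1 - q)\<^sup>2"
      unfolding m(2) by algebra
    also have "m * (1 - q) = 1 + q"
      using q by (simp add: m_q)
    finally have "(1 - q)\<^sup>2 * y = 4 * q"
      by (simp add: power2_eq_square algebra_simps)
    then have "(1 - q)\<^sup>2 * (1 + y * (1 - cos \<phi>) / 2) = (1 - q)\<^sup>2 + 4 * q * (1 - cos \<phi>) / 2"
      by (simp add: distrib_left mult.assoc[symmetric])
    also have "\<dots> = D \<phi>"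
      by (simp add: D_def power2_eq_square field_simps)
    finally have "1 + y * (1 - cos \<phi>) / 2 = D \<phi> / (1 - q)\<^sup>2"
      using q by (simp add: eq_divide_eq mult.commute)
    then show ?thesis
      by simp
  qed
  \<comment> \<open>The \<open>arctan\<close> term is minus the argument of
    \<open>1 - q * cis \<phi>\<close>. It vanishes at 0 and at \<open>pi\<close>, so only
    \<open>pi / m\<close> survives.\<close>
  let ?G = "\<lambda>\<phi>. (\<phi> + 2 * arctan (q * sin \<phi> / (1 - q * cos \<phi>))) / m"
  have "(?G has_real_derivative (1 - q)\<^sup>2 / D \<phi>) (at \<phi> within S)" for \<phi> S
  proof -
    let ?c = "1 - q * cos \<phi>"
    have "((\<lambda>\<phi>. q * sin \<phi> / (1 - q * cos \<phi>)) has_real_derivative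
        (q * cos \<phi> * ?c - q * sin \<phi> * (q * sin \<phi>)) / (?c * ?c)) (at \<phi> within S)"
      using cos[of \<phi>] by (auto intro!: derivative_eq_intros)
    then have "(?G has_real_derivative (1 + 2 * (inverse (1 + (q * sin \<phi> / ?c)\<^sup>2)
        * ((q * cos \<phi> * ?c - q * sin \<phi> * (q * sin \<phi>)) / (?c * ?c)))) / m) (at \<phi> within S)"
      by (intro DERIV_cdivide DERIV_add DERIV_ident DERIV_cmult DERIV_chain2[OF DERIV_arctan])
    moreover have "inverse (1 + (q * sin \<phi> / ?c)\<^sup>2) = ?c\<^sup>2 / D \<phi>"
      unfolding D using cos[of \<phi>] by (simp add: power_divide divide_simps)
    moreover have "q * cos \<phi> * ?c - q * sin \<phi> * (q * sin \<phi>) = q * cos \<phi> - q\<^sup>2"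
      using sin_squared_eq[of \<phi>] unfolding power2_eq_square by algebra
    moreover have "(1 + 2 * (?c\<^sup>2 / D \<phi> * ((q * cos \<phi> - q\<^sup>2) / (?c * ?c)))) / m = (1 - q)\<^sup>2 / D \<phi>"
    proof -
      have "?c\<^sup>2 / D \<phi> * ((q * cos \<phi> - q\<^sup>2) / (?c * ?c)) = (q * cos \<phi> - q\<^sup>2) / D \<phi>"
        using cos[of \<phi>] by (simp add: power2_eq_square)
      moreover have "1 + 2 * ((q * cos \<phi> - q\<^sup>2) / D \<phi>) = (1 - q) * (1 + q) / D \<phi>"
        using D_pos[of \<phi>] by (simp add: divide_simps) (simp add: D_def power2_eq_square algebra_simps)
      ultimately show ?thesis
        using q by (simp add: m_q power2_eq_square)
    qed
    ultimately show ?thesis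
      by simp
  qed
  then have "((\<lambda>\<phi>. (1 - q)\<^sup>2 / D \<phi>) has_integral ?G pi - ?G 0) {0..pi}"
    by (intro fundamental_theorem_of_calculus)
      (auto simp: has_real_derivative_iff_has_vector_derivative[symmetric])
  then show ?thesis
    unfolding kernel by (simp add: m_def)
qed

lemma bernstein_sq_sum_le:
  assumes "n \<ge> 1" "x \<in> {0..1}"
  shows "bernstein_sq_sum n x \<le> 1 / sqrt (1 + 4 * (real n - 1) * x * (1 - x))"
proof -
  define y where "y = 4 * (real n - 1) * x * (1 - x)"
  have y: "y \<ge> 0"
    using assms by (simp add: y_def)
  have "pi * bernstein_sq_sum n x \<le> pi / sqrt (1 + y)"
  proof (rule has_integral_le[OF bernstein_sq_integral poisson_kernel_integral[OF y]])
    fix \<phi> :: real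
    \<comment> \<open>\<open>v\<close> is \<open>1 - R\<close>, and it lies in \<open>[0, 1]\<close>
      because \<open>x * (1 - x) \<le> 1 / 4\<close>.\<close>
    define v where "v = 2 * x * (1 - x) * (1 - cos \<phi>)"
    have "x * (1 - x) \<le> 1 / 4"
      using zero_le_power2[of "1 - 2 * x"] by (simp add: power2_eq_square algebra_simps)
    moreover have "0 \<le> x * (1 - x)" "0 \<le> 1 - cos \<phi>" "1 - cos \<phi> \<le> 2"
      using assms cos_ge_minus_one[of \<phi>] by auto
    ultimately have "0 \<le> x * (1 - x) * (1 - cos \<phi>)" "x * (1 - x) * (1 - cos \<phi>) \<le> 1 / 4 * 2"
      by (simp, intro mult_mono) auto
    moreover have "v = 2 * (x * (1 - x) * (1 - cos \<phi>))"
      by (simp add: v_def)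
    ultimately have v: "0 \<le> v" "v \<le> 1"
      by auto
    \<comment> \<open>Bernoulli is applied to \<open>1 + v\<close> rather than \<open>1 - v\<close>:
      the factors then pair up to \<open>(1 - v) * (1 - v ^ 2) ^ (n - 1)\<close>, which is at most
      1.\<close>
    have "1 + real (n - 1) * v \<le> (1 + v) ^ (n - 1)"
      using v by (intro Bernoulli_inequality) auto
    then have "(1 - v) ^ n * (1 + real (n - 1) * v) \<le> (1 - v) ^ n * (1 + v) ^ (n - 1)"
      using v by (intro mult_left_mono) auto
    also have "\<dots> = (1 - v) * (1 - v\<^sup>2) ^ (n - 1)"
      using assms by (cases n) (simp_all add: power_mult_distrib[symmetric] power2_eq_square algebra_simps)
    also have "\<dots> \<le> 1 * 1"
      using v by (intro mult_mono power_le_one) (auto simp: power_le_one)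
    finally have le: "(1 - v) ^ n \<le> 1 / (1 + real (n - 1) * v)"
      using v by (simp add: pos_le_divide_eq add_pos_nonneg)
    \<comment> \<open>The value of \<open>y\<close> is chosen so that the bound is exactly the
      Poisson integrand.\<close>
    have "real (n - 1) * v = y * (1 - cos \<phi>) / 2"
      using assms by (simp add: y_def v_def of_nat_diff)
    then show "(1 - 2 * x * (1 - x) * (1 - cos \<phi>)) ^ n \<le> 1 / (1 + y * (1 - cos \<phi>) / 2)"
      using le by (simp only: v_def)
  qed
  then have "pi * bernstein_sq_sum n x \<le> pi * (1 / sqrt (1 + y))"
    by simp
  then show ?thesis
    unfolding y_def by (simp only: mult_le_cancel_left_pos pi_gt_zero)
qed

theorem theorem4p3:
  fixes n :: nat
  assumes "n \<ge> 1"
  defines "F \<equiv> bernstein_sq_sum"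
  shows
    "(\<forall>x\<in>{0..1}.
        (\<lambda>t. (t + (1 - t) * (1 - 2 * x)\<^sup>2) ^ n / sqrt (t * (1 - t))) absolutely_integrable_on {0..1} \<and>
        F n x = 1 / pi * integral {0..1}
          (\<lambda>t. (t + (1 - t) * (1 - 2 * x)\<^sup>2) ^ n / sqrt (t * (1 - t))) \<and>
        2 * (real n + 1) * F (n + 1) x
          - (2 * real n + 1) * (1 + (1 - 2 * x)\<^sup>2) * F n x
          + 2 * real n * (1 - 2 * x)\<^sup>2 * F (n - 1) x = 0 \<and>
        (1 - 2 * x) * (deriv (F (n + 1)) x - (1 - 2 * x * (1 - x)) * deriv (F n) x)
          = 2 * (real n + 2 * x * (1 - x)) * F n x - 2 * (real n + 1) * F (n + 1) x \<and>
        deriv (F (n + 1)) x - (1 - 2 * x)\<^sup>2 * deriv (F (n - 1)) x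
          = 2 * (1 - 2 * x) * ((2 * real n - 1) * F (n - 1) x - (2 * real n + 1) * F n x))
     \<and>
     (solves_linear_ode2
        (\<lambda>x. x * (1 - x) * (1 - 2 * x))
        (\<lambda>x. 1 + 4 * (real n - 1) * x * (1 - x))
        (\<lambda>x. 2 * real n * (1 - 2 * x))
        UNIV (F n) \<and>
      (\<exists>p :: real poly. \<forall>x. F n x = poly p x) \<and>
      solves_Heun (1/2) 1 (- 2 * real n) 1 1 (- 2 * real n) (- real n) (- {0, 1/2, 1}) (F n) \<and>
      (\<forall>y. solves_linear_ode2
              (\<lambda>x. x * (1 - x) * (1 - 2 * x))
              (\<lambda>x. 1 + 4 * (real n - 1) * x * (1 - x))
              (\<lambda>x. 2 * real n * (1 - 2 * x))
              (- {0, 1/2, 1}) y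
           \<longleftrightarrow> solves_Heun (1/2) 1 (- 2 * real n) 1 1 (- 2 * real n) (- real n) (- {0, 1/2, 1}) y))
     \<and>
     (\<forall>x\<in>{0..1}. F n x \<le> 1 / sqrt (1 + 4 * (real n - 1) * x * (1 - x)))"
proof -
  \<comment> \<open>The Heun claim is pulled back to the polynomial form of the equation, which
    holds on every open set.\<close>
  have "solves_Heun (1/2) 1 (- 2 * real n) 1 1 (- 2 * real n) (- real n) (- {0, 1/2, 1}) (F n)"
    unfolding F_def ode_iff_Heun[symmetric]
    by (intro bernstein_sq_solves_ode assms open_Compl finite_imp_closed) auto
  moreover have "\<exists>p :: real poly. \<forall>x. F n x = poly p x"
    unfolding F_def bernstein_sq_sum_poly by blast
  ultimately show ?thesis
    unfolding F_def
    by (intro conjI ballI allI bernstein_sq_arcsine_integral[THEN conjunct1]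
        bernstein_sq_arcsine_integral[THEN conjunct2] bernstein_sq_recurrence bernstein_sq_deriv_Suc
        bernstein_sq_deriv_diff bernstein_sq_solves_ode ode_iff_Heun bernstein_sq_sum_le
        assms(1) open_UNIV)
qed

end
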